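(* Let $G$ be a finite group. Then the subspace of the complex vector space of complex valued class functions of $G$ spanned (over $\mathbb{C}$) by the rational valued characters of $G$ has dimension equal to the number of conjugacy classes of cyclic subgroups of $G$.
   Context: A class function on $G$ is a function $G \to \mathbb{C}$ that is constant on the conjugacy classes of $G$; the class functions form a complex vector space under pointwise addition and scalar multiplication, with the set $\mathrm{Irr}(G)$ of irreducible complex characters as a basis. A character of $G$ is a linear combination of elements of $\mathrm{Irr}(G)$ with nonnegative integer coefficients that are not all $0$. A character (or class function) is rational valued if all of its values lie in the field $\mathbb{Q}$ of rational numbers. Conjugacy classes of cyclic subgroups are the orbits of $G$ acting by conjugation on the set of its cyclic subgroups (including the trivial subgroup). *)

theory Defs
  imports
    Jordan_Normal_Form.VS_Connect
    "HOL-Algebra.Group_Action"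
    "HOL-Algebra.Generated_Groups"
    "HOL-Library.Function_Algebras"
begin

text \<open>
  Functions on the group are total functions of type \<open>'a \<Rightarrow> complex\<close> that are \<open>0\<close> outside
  \<^term>\<open>carrier G\<close>. They carry the pointwise addition of Function_Algebras and the pointwise
  scalar multiplication below.
\<close>

definition cfun_scale :: "complex \<Rightarrow> ('a \<Rightarrow> complex) \<Rightarrow> 'a \<Rightarrow> complex"
  where "cfun_scale c f = (\<lambda>x. c * f x)"

interpretation cfun: vector_space "cfun_scale :: complex \<Rightarrow> ('a \<Rightarrow> complex) \<Rightarrow> _"
  by unfold_locales (auto simp: cfun_scale_def fun_eq_iff algebra_simps)

definition class_functions :: "('a, 'b) monoid_scheme \<Rightarrow> ('a \<Rightarrow> complex) set"
  where "class_functions G =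
    {f. (\<forall>x. x \<notin> carrier G \<longrightarrow> f x = 0) \<and>
        (\<forall>g\<in>carrier G. \<forall>x\<in>carrier G. f (g \<otimes>\<^bsub>G\<^esub> x \<otimes>\<^bsub>G\<^esub> inv\<^bsub>G\<^esub> g) = f x)}"

lemma subspace_class_functions:
  assumes "group G"
  shows "cfun.subspace (class_functions G)"
  unfolding cfun.subspace_def class_functions_def cfun_scale_def by auto

definition GL :: "nat \<Rightarrow> complex mat monoid"
  where "GL n = units_of (ring_mat TYPE(complex) n ())"

definition mat_trace :: "complex mat \<Rightarrow> complex"
  where "mat_trace A = (\<Sum>i<dim_row A. A $$ (i, i))"

definition irreducible_rep ::
  "('a, 'b) monoid_scheme \<Rightarrow> nat \<Rightarrow> ('a \<Rightarrow> complex mat) \<Rightarrow> bool"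
  where "irreducible_rep G n \<rho> \<longleftrightarrow>
    \<rho> \<in> hom G (GL n) \<and> n > 0 \<and>
    (\<forall>W. VectorSpace.subspace class_ring W (module_vec TYPE(complex) n) \<and>
         (\<forall>g\<in>carrier G. \<forall>w\<in>W. \<rho> g *\<^sub>v w \<in> W)
       \<longrightarrow> W = {0\<^sub>v n} \<or> W = carrier_vec n)"

definition rep_character ::
  "('a, 'b) monoid_scheme \<Rightarrow> ('a \<Rightarrow> complex mat) \<Rightarrow> 'a \<Rightarrow> complex"
  where "rep_character G \<rho> = (\<lambda>g. if g \<in> carrier G then mat_trace (\<rho> g) else 0)"

definition Irr :: "('a, 'b) monoid_scheme \<Rightarrow> ('a \<Rightarrow> complex) set"
  where "Irr G = {rep_character G \<rho> | n \<rho>. irreducible_rep G n \<rho>}"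

text \<open>
  A linear combination ranges over a finite set \<open>S\<close> of irreducible characters carrying the
  nonzero coefficients, so that the definition does not rely on \<^term>\<open>Irr G\<close> being finite.
\<close>

definition characters :: "('a, 'b) monoid_scheme \<Rightarrow> ('a \<Rightarrow> complex) set"
  where "characters G =
    {\<Sum>\<psi>\<in>S. cfun_scale (of_nat (m \<psi>)) \<psi> | S m.
       finite S \<and> S \<noteq> {} \<and> S \<subseteq> Irr G \<and> (\<forall>\<psi>\<in>S. (m \<psi> :: nat) > 0)}"

definition rational_characters :: "('a, 'b) monoid_scheme \<Rightarrow> ('a \<Rightarrow> complex) set"
  where "rational_characters G = {\<chi> \<in> characters G. \<forall>g\<in>carrier G. \<chi> g \<in> \<rat>}"

definition cyclic_subgroups :: "('a, 'b) monoid_scheme \<Rightarrow> 'a set set"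
  where "cyclic_subgroups G = {generate G {x} | x. x \<in> carrier G}"

definition cyclic_subgroup_classes :: "('a, 'b) monoid_scheme \<Rightarrow> 'a set set set"
  where "cyclic_subgroup_classes G =
    orbits G (cyclic_subgroups G)
      (\<lambda>g. \<lambda>H\<in>cyclic_subgroups G. g <#\<^bsub>G\<^esub> H #>\<^bsub>G\<^esub> inv\<^bsub>G\<^esub> g)"

lemma mat_trace_mult_commute:
  assumes "A \<in> carrier_mat n n" "B \<in> carrier_mat n n"
  shows "mat_trace (A * B) = mat_trace (B * A)"
proof -
  have "mat_trace (A * B) = (\<Sum>i<n. \<Sum>j<n. A $$ (i, j) * B $$ (j, i))"
    using assms by (simp add: mat_trace_def scalar_prod_def atLeast0LessThan)
  also have "\<dots> = (\<Sum>j<n. \<Sum>i<n. B $$ (j, i) * A $$ (i, j))"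
    by (subst sum.swap) (simp add: mult.commute)
  also have "\<dots> = mat_trace (B * A)"
    using assms by (simp add: mat_trace_def scalar_prod_def atLeast0LessThan)
  finally show ?thesis .
qed

lemma rep_character_class_function:
  assumes "group G" "\<rho> \<in> hom G (GL n)"
  shows "rep_character G \<rho> \<in> class_functions G"
proof -
  interpret group G by fact
  have car: "\<rho> g \<in> carrier_mat n n" if "g \<in> carrier G" for g
    using assms(2) that
    by (auto simp: GL_def units_of_def Units_def ring_mat_def hom_def Pi_iff)
  have mult: "\<rho> (g \<otimes>\<^bsub>G\<^esub> h) = \<rho> g * \<rho> h" if "g \<in> carrier G" "h \<in> carrier G" for g h
    using hom_mult[OF assms(2) that] by (simp add: GL_def units_of_def ring_mat_def)
  have "mat_trace (\<rho> (g \<otimes>\<^bsub>G\<^esub> x \<otimes>\<^bsub>G\<^esub> inv\<^bsub>G\<^esub> g)) = mat_trace (\<rho> x)"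
    if "g \<in> carrier G" "x \<in> carrier G" for g x
  proof -
    have "mat_trace (\<rho> (g \<otimes>\<^bsub>G\<^esub> x \<otimes>\<^bsub>G\<^esub> inv\<^bsub>G\<^esub> g)) = mat_trace (\<rho> (g \<otimes>\<^bsub>G\<^esub> x) * \<rho> (inv\<^bsub>G\<^esub> g))"
      using that by (simp add: mult)
    also have "\<dots> = mat_trace (\<rho> (inv\<^bsub>G\<^esub> g) * \<rho> (g \<otimes>\<^bsub>G\<^esub> x))"
      using that car by (intro mat_trace_mult_commute) auto
    also have "\<dots> = mat_trace (\<rho> x)"
      using that by (simp flip: mult add: m_assoc[symmetric])
    finally show ?thesis .
  qed
  then show ?thesis
    by (auto simp: class_functions_def rep_character_def)
qed

lemma characters_subset_class_functions:
  assumes "group G"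
  shows "characters G \<subseteq> class_functions G"
proof -
  have "Irr G \<subseteq> class_functions G"
    using rep_character_class_function[OF assms]
    by (auto simp: Irr_def irreducible_rep_def)
  then show ?thesis
    unfolding characters_def
    by (auto intro!: cfun.subspace_sum cfun.subspace_scale subspace_class_functions[OF assms])
qed

lemma span_rational_characters_subset_class_functions:
  assumes "group G"
  shows "cfun.span (rational_characters G) \<subseteq> class_functions G"
  using characters_subset_class_functions[OF assms]
  by (intro cfun.span_minimal subspace_class_functions assms) (auto simp: rational_characters_def)

lemma (in group) cyclic_subgroups_subgroup: "H \<in> cyclic_subgroups G \<Longrightarrow> subgroup H G"
  by (auto simp: cyclic_subgroups_def intro: generate_is_subgroup)

end

theory Submission
  imports
    Defs
    "HOL-Algebra.Multiplicative_Group"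
    "HOL-Number_Theory.Residues"
    Jordan_Normal_Form.Schur_Decomposition
    Jordan_Normal_Form.DL_Rank
begin

text \<open>
  Let \<open>E\<close> be the set of indicator functions \<open>e_K\<close>, one for each conjugacy class \<open>K\<close> of cyclic
  subgroups, where \<open>e_K\<close> takes the value \<open>1\<close> at the elements that generate a member of \<open>K\<close>. These functions
  have disjoint nonempty supports, so they are linearly independent, and \<open>E\<close> has as many elements as there
  are classes. The theorem holds because the rational characters and \<open>E\<close> span the same space.

  The rational characters lie in the span of \<open>E\<close>: a rational character \<open>\<chi>\<close> takes the same value at two
  generators \<open>x\<close> and \<open>x^k\<close> of a cyclic group of order \<open>N\<close>. On powers of \<open>x\<close> it is a power sum
  \<open>\<chi>(x^k) = l1^k + \<dots> + ld^k\<close> of \<open>N\<close>-th roots of unity. The values at \<open>x\<close> and at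
  \<open>x^k\<close> are compared by congruences (\<open>rational_power_sums_coprime_eq\<close>). Rational
  values are integers, since sums of roots of unity are algebraic integers. For a prime \<open>p\<close>, the binomial
  theorem and Fermat's little theorem give \<open>\<chi>(x^p) \<equiv> \<chi>(x)^p \<equiv> \<chi>(x)\<close> modulo \<open>p\<close>. As all values are
  bounded by \<open>d\<close>, the two integers agree once \<open>p > 2d\<close>. Finally every \<open>k\<close> coprime to \<open>N\<close> is congruent
  modulo \<open>N\<close> to a positive number that has only large prime factors, and these can be stripped off one by one.

  \<open>E\<close> lies in the span of the rational characters: the permutation character \<open>\<pi>\<close> of \<open>G\<close> on the cosets of
  a cyclic subgroup \<open>C\<close> has natural numbers as values, and it vanishes exactly at the elements without a
  conjugate in \<open>C\<close>. When \<open>\<pi>\<close> is expanded in the indicator functions, the coefficient at the class of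
  \<open>C\<close> is therefore nonzero and all other contributions come from strictly smaller cyclic subgroups, so
  induction on the order of \<open>C\<close> applies (\<open>class_indicator_in_span_rational_characters\<close>).

  That \<open>\<pi>\<close> is a sum of irreducible characters follows from a composition series: an invariant subspace
  brings all matrices of a representation to block triangular form, so the trace is the sum of the traces of
  two smaller representations (\<open>rep_character_in_characters\<close>).
\<close>

section \<open>Rings of sums of roots of unity\<close>

text \<open>
  For \<open>N > 0\<close> this is the ring \<open>\<int>[\<zeta>]\<close> with a primitive \<open>N\<close>-th root of unity \<open>\<zeta>\<close>. The sum runs over all \<open>N\<close>-th roots rather
  than over powers of a chosen \<open>\<zeta>\<close>: multiplication by a root then just permutes the summands, and roots of
  unity from any source are elements by inspection.
\<close>
definition unity_ring :: "nat \<Rightarrow> complex set"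
  where "unity_ring N = range (\<lambda>c. \<Sum>u | u ^ N = 1. of_int (c u) * u)"

lemma unity_ringI: "x = (\<Sum>u | u ^ N = 1. of_int (c u) * u) \<Longrightarrow> x \<in> unity_ring N"
  by (simp add: unity_ring_def)

lemma unity_ring_add:
  assumes "x \<in> unity_ring N" "y \<in> unity_ring N"
  shows "x + y \<in> unity_ring N"
proof -
  obtain c d where "x = (\<Sum>u | u ^ N = 1. of_int (c u) * u)" "y = (\<Sum>u | u ^ N = 1. of_int (d u) * u)"
    using assms by (auto simp: unity_ring_def)
  then have "x + y = (\<Sum>u | u ^ N = 1. of_int (c u + d u) * u)"
    by (simp add: sum.distrib algebra_simps)
  then show ?thesis by (rule unity_ringI)
qed

lemma unity_ring_of_int_mult:
  assumes "x \<in> unity_ring N"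
  shows "of_int k * x \<in> unity_ring N"
proof -
  obtain c where "x = (\<Sum>u | u ^ N = 1. of_int (c u) * u)"
    using assms by (auto simp: unity_ring_def)
  then have "of_int k * x = (\<Sum>u | u ^ N = 1. of_int (k * c u) * u)"
    by (simp add: sum_distrib_left algebra_simps)
  then show ?thesis by (rule unity_ringI)
qed

lemma unity_ring_0: "0 \<in> unity_ring N"
  by (rule unity_ringI[where c = "\<lambda>_. 0"]) simp

lemma unity_ring_sum:
  "(\<And>i. i \<in> A \<Longrightarrow> f i \<in> unity_ring N) \<Longrightarrow> sum f A \<in> unity_ring N"
  by (induct A rule: infinite_finite_induct) (auto intro: unity_ring_0 unity_ring_add)

lemma unity_ring_root:
  assumes "N > 0" "w ^ N = 1"
  shows "w \<in> unity_ring N"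
proof -
  have "(\<Sum>u | u ^ N = 1. of_int (if u = w then 1 else 0) * u) = (\<Sum>u | u ^ N = 1. if u = w then u else 0)"
    by (rule sum.cong) auto
  also have "\<dots> = w"
    using assms by (subst sum.delta) (auto simp: finite_roots_unity)
  finally show ?thesis by (intro unity_ringI[OF sym])
qed

lemma unity_ring_root_mult:
  assumes "N > 0" "w ^ N = 1" "x \<in> unity_ring N"
  shows "w * x \<in> unity_ring N"
proof -
  obtain c where x: "x = (\<Sum>u | u ^ N = 1. of_int (c u) * u)"
    using assms by (auto simp: unity_ring_def)
  have w: "w \<noteq> 0" using assms by (auto simp: power_0_left)
  have "w * x = (\<Sum>u | u ^ N = 1. of_int (c u) * (w * u))"
    by (simp add: x sum_distrib_left algebra_simps)
  also have "\<dots> = (\<Sum>u | u ^ N = 1. of_int (c (u / w)) * u)"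
    by (rule sum.reindex_bij_witness[of _ "\<lambda>u. u / w" "\<lambda>u. w * u"])
       (use w assms(2) in \<open>auto simp: power_mult_distrib power_divide\<close>)
  finally show ?thesis by (rule unity_ringI)
qed

lemma unity_ring_mult:
  assumes "N > 0" "x \<in> unity_ring N" "y \<in> unity_ring N"
  shows "x * y \<in> unity_ring N"
proof -
  obtain c where "x = (\<Sum>u | u ^ N = 1. of_int (c u) * u)"
    using assms by (auto simp: unity_ring_def)
  then have "x * y = (\<Sum>u | u ^ N = 1. of_int (c u) * (u * y))"
    by (simp add: sum_distrib_right mult.assoc)
  then show ?thesis
    using assms by (auto intro!: unity_ring_sum unity_ring_of_int_mult unity_ring_root_mult)
qed

lemma unity_ring_power:
  assumes "N > 0" "x \<in> unity_ring N"
  shows "x ^ k \<in> unity_ring N"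
  by (induct k) (use assms in \<open>auto intro: unity_ring_mult unity_ring_root\<close>)

text \<open>
  The characteristic polynomial of an integer matrix is monic with integer coefficients.
\<close>
lemma eigenvalue_int_mat_algebraic_int:
  assumes M: "M \<in> carrier_mat n n" and ev: "eigenvalue (map_mat of_int M) (z :: complex)"
  shows "algebraic_int z"
proof -
  have C: "map_mat of_int M \<in> carrier_mat n n" using M by simp
  have "poly (map_poly of_int (char_poly M)) z = 0"
    using ev unfolding eigenvalue_root_char_poly[OF C] of_int_hom.char_poly_hom[OF M] .
  moreover have "lead_coeff (char_poly M) = 1"
    using degree_monic_char_poly[OF M] by auto
  ultimately show ?thesis by (auto simp: algebraic_int_altdef_ipoly)
qed

text \<open>
  Multiplication by \<open>z\<close> maps each root of unity to an integer combination of roots of unity. The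
  coefficients form an integer matrix, and the vector of all roots is an eigenvector for \<open>z\<close>.
\<close>
lemma unity_ring_algebraic_int:
  assumes N: "N > 0" and z: "z \<in> unity_ring N"
  shows "algebraic_int z"
proof -
  define U where "U = {u :: complex. u ^ N = 1}"
  have finU: "finite U" unfolding U_def using N by (simp add: finite_roots_unity)
  define n where "n = card U"
  obtain e where e: "bij_betw e {..<n} U"
    using finU ex_bij_betw_nat_finite[of U] by (auto simp: n_def atLeast0LessThan)
  have eU: "e i ^ N = 1" if "i < n" for i
    using e that by (auto simp: bij_betw_def U_def)
  have "\<exists>c. e i * z = (\<Sum>u\<in>U. of_int (c u) * u)" if "i < n" for i
    using unity_ring_root_mult[OF N eU[OF that] z] unfolding unity_ring_def U_def by blast
  then obtain c where c: "\<And>i. i < n \<Longrightarrow> e i * z = (\<Sum>u\<in>U. of_int (c i u) * u)"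
    by metis
  define M :: "int mat" where "M = mat n n (\<lambda>(i, j). c i (e j))"
  have M: "M \<in> carrier_mat n n" by (simp add: M_def)
  define v where "v = vec n e"
  have "1 \<in> U" by (simp add: U_def)
  then obtain i0 where i0: "i0 < n" "e i0 = 1"
    using e by (auto simp: bij_betw_def image_iff)
  have "map_mat of_int M *\<^sub>v v = z \<cdot>\<^sub>v v"
  proof (rule eq_vecI)
    fix i assume "i < dim_vec (z \<cdot>\<^sub>v v)"
    then have i: "i < n" by (simp add: v_def)
    have "(map_mat of_int M *\<^sub>v v) $ i = (\<Sum>j<n. of_int (c i (e j)) * e j)"
      using i by (simp add: M_def v_def scalar_prod_def atLeast0LessThan)
    also have "\<dots> = (\<Sum>u\<in>U. of_int (c i u) * u)"
      by (rule sum.reindex_bij_betw[OF e, of "\<lambda>u. of_int (c i u) * u"])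
    also have "\<dots> = (z \<cdot>\<^sub>v v) $ i" using i c[OF i] by (simp add: v_def mult.commute)
    finally show "(map_mat of_int M *\<^sub>v v) $ i = (z \<cdot>\<^sub>v v) $ i" .
  qed (simp add: M_def v_def)
  moreover have "v \<noteq> 0\<^sub>v n"
    using i0 by (metis index_vec index_zero_vec(1) v_def zero_neq_one)
  ultimately have "eigenvalue (map_mat of_int M) z"
    unfolding eigenvalue_def eigenvector_def using M by (intro exI[of _ v]) (auto simp: v_def)
  then show ?thesis using eigenvalue_int_mat_algebraic_int[OF M] by blast
qed

corollary unity_ring_rat_int:
  assumes "N > 0" "z \<in> unity_ring N" "z \<in> \<rat>"
  shows "z \<in> \<int>"
  using rational_algebraic_int_is_int unity_ring_algebraic_int assms by blast

text \<open>
  The Frobenius congruence: the inner binomial coefficients are divisible by \<open>p\<close>.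
\<close>
lemma unity_ring_add_power_prime:
  assumes N: "N > 0" and p: "prime p" and a: "a \<in> unity_ring N" and b: "b \<in> unity_ring N"
  shows "\<exists>r\<in>unity_ring N. (a + b) ^ p = a ^ p + b ^ p + of_nat p * r"
proof -
  have p0: "p > 1" using p prime_gt_1_nat by blast
  define r where "r = (\<Sum>k\<in>{0<..<p}. of_int (int ((p choose k) div p)) * (a ^ k * b ^ (p - k)))"
  have "r \<in> unity_ring N"
    unfolding r_def using N a b
    by (intro unity_ring_sum unity_ring_of_int_mult unity_ring_mult unity_ring_power)
  have "{..p} = insert 0 (insert p {0<..<p})" using p0 by auto
  then have "(a + b) ^ p = a ^ p + b ^ p + (\<Sum>k\<in>{0<..<p}. of_nat (p choose k) * a ^ k * b ^ (p - k))"
    using p0 by (simp add: binomial_ring)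
  also have "(\<Sum>k\<in>{0<..<p}. of_nat (p choose k) * a ^ k * b ^ (p - k)) = of_nat p * r"
    unfolding r_def sum_distrib_left
  proof (rule sum.cong[OF refl])
    fix k assume "k \<in> {0<..<p}"
    then have "p dvd p choose k" using p by (intro dvd_choose_prime) auto
    then have "(of_nat (p choose k) :: complex) = of_nat p * of_nat ((p choose k) div p)"
      by (metis dvd_mult_div_cancel of_nat_mult)
    then show "of_nat (p choose k) * a ^ k * b ^ (p - k)
        = of_nat p * (of_int (int ((p choose k) div p)) * (a ^ k * b ^ (p - k)))"
      by (simp add: mult.assoc)
  qed
  finally show ?thesis using \<open>r \<in> unity_ring N\<close> by blast
qed

lemma unity_ring_sum_list:
  "N > 0 \<Longrightarrow> \<forall>l\<in>set ls. l ^ N = 1 \<Longrightarrow> sum_list ls \<in> unity_ring N"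
  by (induct ls) (auto intro: unity_ring_0 unity_ring_add unity_ring_root)

lemma unity_ring_sum_list_power_prime:
  assumes N: "N > 0" and p: "prime p" and "\<forall>l\<in>set ls. l ^ N = 1"
  shows "\<exists>r\<in>unity_ring N. sum_list ls ^ p = (\<Sum>l\<leftarrow>ls. l ^ p) + of_nat p * r"
  using assms(3)
proof (induct ls)
  case Nil
  then show ?case using p by (auto intro!: bexI[of _ 0] unity_ring_0 simp: power_0_left)
next
  case (Cons l ls)
  then obtain r where r: "r \<in> unity_ring N" "sum_list ls ^ p = (\<Sum>l\<leftarrow>ls. l ^ p) + of_nat p * r" by auto
  obtain s where s: "s \<in> unity_ring N" "(l + sum_list ls) ^ p = l ^ p + sum_list ls ^ p + of_nat p * s"
    using unity_ring_add_power_prime[OF N p, of l "sum_list ls"] Cons(2) unity_ring_sum_list[OF N, of ls] unity_ring_root[OF N, of l]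
    by auto
  show ?case
    by (rule bexI[of _ "r + s"]) (use r s in \<open>auto simp: algebra_simps intro: unity_ring_add\<close>)
qed

section \<open>Rational power sums of roots of unity\<close>

text \<open>
  Both sums are integers of absolute value at most the number of summands. The Frobenius congruence together
  with Fermat's little theorem makes them congruent modulo \<open>p\<close>, which is larger than any difference they
  could have.
\<close>
lemma power_sum_prime_eq:
  fixes ls :: "complex list"
  assumes N: "N > 0" and ls: "\<forall>l\<in>set ls. l ^ N = 1"
    and p: "prime p" "p > 2 * length ls"
    and rat: "sum_list ls \<in> \<rat>" "(\<Sum>l\<leftarrow>ls. l ^ p) \<in> \<rat>"
  shows "(\<Sum>l\<leftarrow>ls. l ^ p) = sum_list ls"
proof -
  have p0: "p > 0" using p by simp
  have lsp: "\<forall>l\<in>set (map (\<lambda>l. l ^ p) ls). l ^ N = 1"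
    using ls by (auto simp flip: power_mult simp: mult.commute[of p]) (simp add: power_mult)
  obtain x where x: "sum_list ls = of_int x"
    using unity_ring_rat_int[OF N unity_ring_sum_list[OF N ls] rat(1)] by (auto elim: Ints_cases)
  obtain y where y: "(\<Sum>l\<leftarrow>ls. l ^ p) = of_int y"
    using unity_ring_rat_int[OF N unity_ring_sum_list[OF N lsp] rat(2)] by (auto elim: Ints_cases)
  obtain r where r: "r \<in> unity_ring N" "(of_int x) ^ p = of_int y + of_nat p * r"
    using unity_ring_sum_list_power_prime[OF N p(1) ls] by (auto simp: x y)
  \<comment> \<open>The remainder term is rational, hence an integer, so the congruence takes place in \<open>\<int>\<close>.\<close>
  have "r = (of_int (x ^ p) - of_int y) / of_nat p" using r p0 by (simp add: field_simps)
  then have "r \<in> \<rat>" by (auto intro!: Rats_divide Rats_diff)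
  then obtain z where z: "r = of_int z" using unity_ring_rat_int[OF N r(1)] by (auto elim: Ints_cases)
  have "(of_int (x ^ p) :: complex) = of_int (y + int p * z)" using r(2) by (simp add: z)
  then have "x ^ p = y + int p * z" using of_int_eq_iff by blast
  then have c1: "[x ^ p = y] (mod int p)" by (simp add: cong_iff_dvd_diff)
  have c2: "[x ^ p = x] (mod int p)"
  proof -
    \<comment> \<open>A natural number in the residue class of \<open>x\<close>, for Fermat's theorem on powers of natural numbers.\<close>
    define m where "m = nat (x mod int p)"
    have m: "[x = int m] (mod int p)" using p0 by (simp add: m_def cong_def)
    have "[m ^ p = m] (mod p)"
    proof (cases "p dvd m")
      case True
      then have "p dvd m ^ p" using p0 by (simp add: dvd_power_le dvd_trans)
      then show ?thesis using True by (simp add: cong_def mod_eq_0_iff_dvd)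
    next
      case False
      then have "[m ^ (p - 1) * m = 1 * m] (mod p)"
        using fermat_theorem[OF p(1)] cong_mult cong_refl by blast
      then show ?thesis using p0 by (simp flip: power_Suc2)
    qed
    then have "[int m ^ p = int m] (mod int p)" by (simp flip: of_nat_power add: cong_int_iff)
    then show ?thesis using m cong_pow[OF m] by (meson cong_sym cong_trans)
  qed
  have "int p dvd x - y" using c1 c2 by (meson cong_iff_dvd_diff cong_sym cong_trans)
  have bnd: "norm (\<Sum>l\<leftarrow>ls'. l) \<le> length ls'" if "\<forall>l\<in>set ls'. l ^ N = 1" for ls' :: "complex list"
    using that
  proof (induct ls')
    case (Cons l ls')
    have "norm l = 1" using power_eq_1_iff[of l N] Cons N by simp
    then show ?case using Cons norm_triangle_ineq[of l "sum_list ls'"] by auto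
  qed auto
  have "\<bar>x\<bar> \<le> length ls" using bnd[OF ls] x by simp
  moreover have "\<bar>y\<bar> \<le> length ls" using bnd[OF lsp] y by simp
  ultimately have "\<bar>x - y\<bar> < int p" using p(2) by linarith
  then have "x = y" using \<open>int p dvd x - y\<close> by (metis dvd_imp_le_int eq_iff_diff_eq_0 not_less abs_of_nat)
  then show ?thesis by (simp add: x y)
qed

text \<open>
  The prime factors have to be large because \<open>power_sum_prime_eq\<close> applies only to primes beyond a bound. The
  witness is \<open>k + N * P\<close>, where \<open>P\<close> is the product of the small primes that do not divide \<open>k\<close>. Every small
  prime divides exactly one of the two summands: if it divides \<open>k\<close>, it does not divide \<open>N\<close> and is not a factor
  of \<open>P\<close>.
\<close>
lemma ex_cong_large_prime_factors:
  fixes k N M :: nat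
  assumes N: "N > 0" and kN: "coprime k N"
  shows "\<exists>q>0. [q = k] (mod N) \<and> (\<forall>p. prime p \<longrightarrow> p dvd q \<longrightarrow> p > M)"
proof -
  define P where "P = {p. prime p \<and> p \<le> M \<and> \<not> p dvd k}"
  have finP: "finite P" unfolding P_def by (rule finite_subset[of _ "{..M}"]) auto
  define q where "q = k + N * \<Prod>P"
  have "q > 0" using N by (auto simp: q_def P_def intro!: prod_pos prime_gt_0_nat)
  moreover have "[q = k] (mod N)" by (simp add: q_def cong_def)
  moreover have "p > M" if p: "prime p" "p dvd q" for p
  proof (rule ccontr)
    assume "\<not> p > M"
    show False
    proof (cases "p dvd k")
      case True
      then have "p dvd N * \<Prod>P" using p(2) by (simp add: q_def dvd_add_right_iff)
      moreover have "\<not> p dvd N" using True kN p(1) by (metis coprime_common_divisor_nat not_prime_1 not_prime_unit coprime_common_divisor)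
      ultimately have "p dvd \<Prod>P" using p(1) prime_dvd_mult_iff by blast
      then obtain p' where "p' \<in> P" "p dvd p'" using prime_dvd_prod_iff[OF finP p(1), of id] by auto
      then show False using True primes_dvd_imp_eq[OF p(1)] by (auto simp: P_def)
    next
      case False
      then have "p \<in> P" using p(1) \<open>\<not> p > M\<close> by (simp add: P_def)
      then have "p dvd N * \<Prod>P" using finP by (metis dvd_mult dvd_prodI id_apply)
      then show False using p(2) False by (simp add: q_def dvd_add_left_iff)
    qed
  qed
  ultimately show ?thesis by blast
qed

text \<open>
  Up to a multiple of \<open>N\<close>, the exponent \<open>k\<close> is a product of large primes. Raising the roots to one such prime
  leaves the sum unchanged, and the hypothesis on rationality is inherited by the list of powers, so the primes
  can be removed one after the other.
\<close>
theorem rational_power_sums_coprime_eq: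
  fixes ls :: "complex list"
  assumes N: "N > 0" and ls: "\<forall>l\<in>set ls. l ^ N = 1"
    and rat: "\<And>k. (\<Sum>l\<leftarrow>ls. l ^ k) \<in> \<rat>"
    and k: "coprime k N"
  shows "(\<Sum>l\<leftarrow>ls. l ^ k) = sum_list ls"
proof -
  have large: "(\<Sum>l\<leftarrow>ls. l ^ q) = sum_list ls"
    if "q > 0" "\<forall>p. prime p \<longrightarrow> p dvd q \<longrightarrow> p > 2 * length ls" for q
    using that
  proof (induction q rule: less_induct)
    case (less q)
    show ?case
    proof (cases "q = 1")
      case False
      then obtain p where p: "prime p" "p dvd q" using prime_factor_nat by blast
      then obtain q' where q': "q = q' * p" by (metis dvdE mult.commute)
      let ?ls = "map (\<lambda>l. l ^ q') ls"
      have roots: "\<forall>l\<in>set ?ls. l ^ N = 1"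
        using ls by (auto simp flip: power_mult simp: mult.commute[of q']) (simp add: power_mult)
      have eq: "(\<Sum>l\<leftarrow>ls. l ^ q) = (\<Sum>l\<leftarrow>?ls. l ^ p)" by (simp add: q' power_mult o_def)
      also have "\<dots> = sum_list ?ls"
        using p less.prems rat[of q'] rat[of q] eq
        by (intro power_sum_prime_eq[OF N roots p(1)]) auto
      also have "\<dots> = sum_list ls"
      proof (rule less.IH)
        show "q' < q" using less.prems(1) p(1) prime_gt_1_nat[OF p(1)] by (simp add: q')
      qed (use less.prems in \<open>auto simp: q'\<close>)
      finally show ?thesis .
    qed simp
  qed
  obtain q where q: "q > 0" "[q = k] (mod N)" "\<forall>p. prime p \<longrightarrow> p dvd q \<longrightarrow> p > 2 * length ls"
    using ex_cong_large_prime_factors[OF N k] by blast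
  have "l ^ k = l ^ q" if "l \<in> set ls" for l
  proof -
    have mod: "l ^ j = l ^ (j mod N)" for j
    proof -
      have "l ^ j = l ^ (N * (j div N) + j mod N)" by simp
      also have "\<dots> = l ^ (j mod N)" using ls that by (simp only: power_add power_mult) simp
      finally show ?thesis .
    qed
    show ?thesis using mod[of k] mod[of q] q(2) by (simp add: cong_def)
  qed
  then have "(\<Sum>l\<leftarrow>ls. l ^ k) = (\<Sum>l\<leftarrow>ls. l ^ q)" by (metis (no_types, lifting) map_cong)
  then show ?thesis using large q by simp
qed

section \<open>Traces of matrices of finite order\<close>

lemma upper_triangular_mult_index:
  fixes A B :: "'a :: comm_ring_1 mat"
  assumes A: "A \<in> carrier_mat n n" "upper_triangular A"
    and B: "B \<in> carrier_mat n n" "upper_triangular B"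
    and ij: "i < n" "j \<le> i"
  shows "(A * B) $$ (i, j) = (if i = j then A $$ (i, i) * B $$ (i, i) else 0)"
proof -
  have "(A * B) $$ (i, j) = (\<Sum>k<n. A $$ (i, k) * B $$ (k, j))"
    using A B ij by (simp add: scalar_prod_def atLeast0LessThan)
  also have "\<dots> = (\<Sum>k<n. if k = i then (if i = j then A $$ (i, i) * B $$ (i, i) else 0) else 0)"
  proof (rule sum.cong[OF refl])
    fix k assume "k \<in> {..<n}"
    then have k: "k < n" by simp
    consider "k < i" | "k = i" | "k > i" by linarith
    then show "A $$ (i, k) * B $$ (k, j) = (if k = i then (if i = j then A $$ (i, i) * B $$ (i, i) else 0) else 0)"
      by cases (use k ij A B in \<open>auto simp: upper_triangularD\<close>)
  qed
  finally show ?thesis using ij by simp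
qed

lemma upper_triangular_pow:
  fixes A :: "'a :: comm_ring_1 mat"
  assumes A: "A \<in> carrier_mat n n" "upper_triangular A"
  shows "upper_triangular (A ^\<^sub>m k) \<and> (\<forall>i<n. (A ^\<^sub>m k) $$ (i, i) = A $$ (i, i) ^ k)"
proof (induct k)
  case 0
  then show ?case using A by auto
next
  case (Suc k)
  have C: "A ^\<^sub>m k \<in> carrier_mat n n" using A by simp
  show ?case
    using upper_triangular_mult_index[OF C _ A] Suc A C by (auto intro!: upper_triangularI simp: mult.commute)
qed

lemma mat_trace_similar:
  assumes "P \<in> carrier_mat n n" "Q \<in> carrier_mat n n" "A \<in> carrier_mat n n" "Q * P = 1\<^sub>m n"
  shows "mat_trace (P * A * Q) = mat_trace A"
proof -
  have "mat_trace (P * A * Q) = mat_trace (Q * (P * A))"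
    by (rule mat_trace_mult_commute) (use assms in auto)
  also have "Q * (P * A) = A"
    using assms by (simp flip: assoc_mult_mat[of Q n n P n A n])
  finally show ?thesis .
qed

text \<open>
  After triangulation the traces of all powers are power sums of the same list, namely the diagonal of the
  triangular matrix.
\<close>
lemma finite_order_mat_trace_pow:
  assumes A: "A \<in> carrier_mat n n" and pow: "A ^\<^sub>m N = 1\<^sub>m n"
  shows "\<exists>ls. (\<forall>l\<in>set ls. l ^ N = 1) \<and> (\<forall>k. mat_trace (A ^\<^sub>m k) = (\<Sum>l\<leftarrow>ls. l ^ k))"
proof -
  obtain es where "char_poly A = (\<Prod>a\<leftarrow>es. [:- a, 1:])"
    using char_poly_factorized[OF A] by blast
  then obtain B where B: "B \<in> carrier_mat n n" "upper_triangular B" "similar_mat A B"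
    using schur_decomposition_exists[OF A] by blast
  then obtain P Q where "similar_mat_wit A B P Q" by (auto simp: similar_mat_def)
  note wit = similar_mat_witD2[OF A this] and id = similar_mat_wit_pow_id[OF this]
  note witB = similar_mat_wit_pow_id[OF similar_mat_wit_sym[OF \<open>similar_mat_wit A B P Q\<close>]]
  have "B ^\<^sub>m N = 1\<^sub>m n" using witB[of N] pow wit by simp
  then have "\<forall>i<n. B $$ (i, i) ^ N = 1"
    using upper_triangular_pow[OF B(1,2), of N] by (metis index_one_mat(1))
  moreover have "mat_trace (A ^\<^sub>m k) = (\<Sum>l\<leftarrow>map (\<lambda>i. B $$ (i, i)) [0..<n]. l ^ k)" for k
  proof -
    have "mat_trace (A ^\<^sub>m k) = mat_trace (B ^\<^sub>m k)"
      unfolding id using wit B by (intro mat_trace_similar) auto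
    also have "\<dots> = (\<Sum>i<n. B $$ (i, i) ^ k)"
      using upper_triangular_pow[OF B(1,2), of k] B by (simp add: mat_trace_def)
    finally show ?thesis by (simp add: interv_sum_list_conv_sum_set_nat atLeast0LessThan o_def)
  qed
  ultimately show ?thesis by (intro exI[of _ "map (\<lambda>i. B $$ (i, i)) [0..<n]"]) auto
qed

section \<open>Bases adapted to a subspace\<close>

text \<open>
  A basis of \<open>W\<close> is extended to one of the whole space; its vectors are the columns of \<open>P\<close>, the
  first \<open>r\<close> of them being those in \<open>W\<close>.
\<close>
lemma subspace_adapted_basis:
  assumes "VectorSpace.subspace class_ring W (module_vec TYPE(complex) n)"
  obtains P Q r where "P \<in> carrier_mat n n" "Q \<in> carrier_mat n n" "P * Q = 1\<^sub>m n" "Q * P = 1\<^sub>m n"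
    "r \<le> n" "\<And>j. j < r \<Longrightarrow> col P j \<in> W" "r = n \<Longrightarrow> W = carrier_vec n"
    "\<And>w. w \<in> W \<Longrightarrow> \<exists>v\<in>carrier_vec n. w = P *\<^sub>v v \<and> (\<forall>i. r \<le> i \<longrightarrow> i < n \<longrightarrow> v $ i = 0)"
proof -
  interpret vec_space "TYPE(complex)" n .
  have sub: "submodule class_ring W V"
    using assms by (simp add: VectorSpace.subspace_def)
  have Wc: "W \<subseteq> carrier_vec n" using sub by (auto simp: submodule_def)
  have bound: "finite A \<and> card A \<le> n" if "A \<subseteq> carrier_vec n" "lin_indpt A" for A
    using li_le_dim[OF fin_dim] that dim_is_n by auto
  obtain S where S: "finite S" "maximal S (\<lambda>S. S \<subseteq> W \<and> lin_indpt S)"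
  proof -
    have "\<exists>S. finite S \<and> maximal S (\<lambda>S. S \<subseteq> W \<and> lin_indpt S)"
    proof (rule maximal_exists[of _ n "{}"])
      fix A assume "A \<subseteq> W \<and> lin_indpt A"
      then show "finite A \<and> card A \<le> n" using bound[of A] Wc by blast
    qed (simp add: finite_lin_indpt2)
    then show ?thesis using that by blast
  qed
  have SW: "S \<subseteq> W" and liS: "lin_indpt S" using S(2) by (auto simp: maximal_def)
  have Sc: "S \<subseteq> carrier_vec n" using SW Wc by blast
  have Wspan: "W \<subseteq> span S"
  proof
    fix w assume w: "w \<in> W"
    show "w \<in> span S"
    proof (rule ccontr)
      assume no: "w \<notin> span S"
      then have "w \<notin> S" using in_own_span[of S] Sc by auto
      then have "lin_indpt (S \<union> {w})" using lin_dep_iff_in_span[of S w] no Sc liS w Wc by auto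
      moreover have "S \<subseteq> S \<union> {w}" "S \<union> {w} \<subseteq> W" using w SW by auto
      ultimately have "S \<union> {w} = S" using S(2) unfolding maximal_def by metis
      then show False using \<open>w \<notin> S\<close> by blast
    qed
  qed
  have "span S \<subseteq> W" using span_is_subset[OF SW sub] .
  then have W: "W = span S" using Wspan by blast
  obtain T where T: "finite T" "maximal T (\<lambda>T. T \<subseteq> carrier_vec n \<and> lin_indpt T)" "S \<subseteq> T"
  proof -
    have "\<exists>T. finite T \<and> maximal T (\<lambda>T. S \<subseteq> T \<and> T \<subseteq> carrier_vec n \<and> lin_indpt T)"
    proof (rule maximal_exists[of _ n S])
      fix A assume "S \<subseteq> A \<and> A \<subseteq> carrier_vec n \<and> lin_indpt A"
      then show "finite A \<and> card A \<le> n" using bound by blast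
    qed (simp add: liS Sc)
    then obtain T where T: "finite T" "maximal T (\<lambda>T. S \<subseteq> T \<and> T \<subseteq> carrier_vec n \<and> lin_indpt T)" by blast
    then have ST: "S \<subseteq> T" and Tp: "T \<subseteq> carrier_vec n" "lin_indpt T"
      and max: "\<And>B. T \<subseteq> B \<Longrightarrow> S \<subseteq> B \<and> B \<subseteq> carrier_vec n \<and> lin_indpt B \<Longrightarrow> B = T"
      unfolding maximal_def by simp_all
    have "maximal T (\<lambda>T. T \<subseteq> carrier_vec n \<and> lin_indpt T)"
      unfolding maximal_def using Tp max subset_trans[OF ST] by metis
    then show ?thesis by (rule that[OF T(1) _ ST])
  qed
  have Tc: "T \<subseteq> carrier_vec n" and liT: "lin_indpt T" using T(2) by (auto simp: maximal_def)
  have "basis T" using max_li_is_basis T(2) by simp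
  then have cardT: "card T = n" using dim_basis[OF T(1)] dim_is_n by simp
  obtain us where us: "set us = S" "distinct us" using finite_distinct_list[OF S(1)] by blast
  obtain ws where ws: "set ws = T - S" "distinct ws" using finite_distinct_list[of "T - S"] T(1) by blast
  define r where "r = length us"
  have setT: "set (us @ ws) = T" and dist: "distinct (us @ ws)" using us ws T(3) by auto
  have len: "length (us @ ws) = n" using distinct_card[OF dist] setT cardT by simp
  define P where "P = mat_of_cols n (us @ ws)"
  have P: "P \<in> carrier_mat n n" using len by (simp add: P_def mat_of_cols_def)
  have cols: "cols P = us @ ws" unfolding P_def using Tc setT by (intro cols_mat_of_cols) auto
  have colP: "col P j = (us @ ws) ! j" if "j < n" for j
    using cols cols_nth[of j P] P that by simp
  have "rank P = n" using lin_indpt_full_rank[OF P] cols setT dist liT by simp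
  then have "det P \<noteq> 0" using det_rank_iff[OF P] by simp
  then have "P \<in> Units (ring_mat TYPE(complex) n ())" by (rule det_non_zero_imp_unit[OF P])
  then obtain Q where Q: "Q \<in> carrier_mat n n" "P * Q = 1\<^sub>m n" "Q * P = 1\<^sub>m n"
    by (auto simp: Units_def ring_mat_def)
  show ?thesis
  proof (rule that[OF P Q, of r])
    show "r \<le> n" using len by (simp add: r_def)
    show "col P j \<in> W" if "j < r" for j
      using that colP[of j] len us(1) SW nth_mem[of j us] by (auto simp: r_def nth_append)
    show "W = carrier_vec n" if "r = n"
    proof -
      have "ws = []" using that len by (simp add: r_def)
      then have "S = T" using setT us(1) by simp
      then show ?thesis using \<open>basis T\<close> W by (simp add: basis_def)
    qed
    show "\<exists>v\<in>carrier_vec n. w = P *\<^sub>v v \<and> (\<forall>i. r \<le> i \<longrightarrow> i < n \<longrightarrow> v $ i = 0)" if w: "w \<in> W" for w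
    proof -
      obtain a where a: "w = lincomb a S"
        using finite_in_span[OF S(1) _ subsetD[OF Wspan w]] Sc by auto
      define b where "b x = (if x \<in> S then a x else 0)" for x
      define v where "v = vec n (\<lambda>i. b (col P i))"
      have "P *\<^sub>v v = lincomb b T"
        unfolding v_def using mat_mult_eq_lincomb[OF P, of b] cols dist setT by simp
      also have "\<dots> = lincomb a S"
      proof (rule eq_vecI)
        fix i assume "i < dim_vec (lincomb a S)"
        then have i: "i < n" using lincomb_dim[OF S(1) Sc] by simp
        show "lincomb b T $ i = lincomb a S $ i"
          unfolding lincomb_index[OF i Tc] lincomb_index[OF i Sc]
          by (rule sum.mono_neutral_cong_right) (use T in \<open>auto simp: b_def\<close>)
      qed (use lincomb_dim[OF S(1) Sc] lincomb_dim[OF T(1) Tc] in simp)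
      finally have "w = P *\<^sub>v v" using a by simp
      moreover have "v $ i = 0" if i: "r \<le> i" "i < n" for i
      proof -
        have "col P i = ws ! (i - r)" using colP[OF i(2)] i(1) by (simp add: nth_append r_def)
        moreover have "i - r < length ws" using i len by (simp add: r_def)
        ultimately have "col P i \<notin> S" using ws(1) nth_mem[of "i - r" ws] by auto
        then show ?thesis using i by (simp add: v_def b_def)
      qed
      ultimately show ?thesis by (intro bexI[of _ v]) (auto simp: v_def)
    qed
  qed
qed

section \<open>Characters of arbitrary representations\<close>

lemma Irr_subset_characters: "Irr G \<subseteq> characters G"
proof
  fix \<psi> assume "\<psi> \<in> Irr G"
  moreover have "\<psi> = (\<Sum>\<psi>'\<in>{\<psi>}. cfun_scale (of_nat 1) \<psi>')" by (simp add: cfun_scale_def)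
  ultimately show "\<psi> \<in> characters G"
    unfolding characters_def by (intro CollectI exI[of _ "{\<psi>}"] exI[of _ "\<lambda>_. 1"]) auto
qed

text \<open>
  The two sets of irreducible constituents may overlap, so multiplicities are added on their union.
\<close>
lemma characters_add:
  assumes "\<chi> \<in> characters G" "\<chi>' \<in> characters G"
  shows "\<chi> + \<chi>' \<in> characters G"
proof -
  obtain S m where S: "\<chi> = (\<Sum>\<psi>\<in>S. cfun_scale (of_nat (m \<psi>)) \<psi>)" "finite S" "S \<noteq> {}" "S \<subseteq> Irr G"
      "\<forall>\<psi>\<in>S. (m \<psi> :: nat) > 0"
    using assms(1) by (auto simp: characters_def)
  obtain S' m' where S': "\<chi>' = (\<Sum>\<psi>\<in>S'. cfun_scale (of_nat (m' \<psi>)) \<psi>)" "finite S'" "S' \<subseteq> Irr G"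
      "\<forall>\<psi>\<in>S'. (m' \<psi> :: nat) > 0"
    using assms(2) by (auto simp: characters_def)
  define k where "k \<psi> = (if \<psi> \<in> S then m \<psi> else 0) + (if \<psi> \<in> S' then m' \<psi> else 0)" for \<psi>
  have "\<chi> = (\<Sum>\<psi>\<in>S \<union> S'. cfun_scale (of_nat (if \<psi> \<in> S then m \<psi> else 0)) \<psi>)"
    unfolding S(1) by (rule sum.mono_neutral_cong_left) (use S S' in auto)
  moreover have "\<chi>' = (\<Sum>\<psi>\<in>S \<union> S'. cfun_scale (of_nat (if \<psi> \<in> S' then m' \<psi> else 0)) \<psi>)"
    unfolding S'(1) by (rule sum.mono_neutral_cong_left) (use S S' in auto)
  ultimately have "\<chi> + \<chi>' = (\<Sum>\<psi>\<in>S \<union> S'. cfun_scale (of_nat (k \<psi>)) \<psi>)"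
    by (simp only: k_def of_nat_add cfun.scale_left_distrib sum.distrib)
  then show ?thesis
    unfolding characters_def using S S'
    by (intro CollectI exI[of _ "S \<union> S'"] exI[of _ k]) (auto simp: k_def)
qed

context group begin

lemma GL_hom_carrier: "\<rho> \<in> hom G (GL n) \<Longrightarrow> g \<in> carrier G \<Longrightarrow> \<rho> g \<in> carrier_mat n n"
  by (auto simp: GL_def units_of_def Units_def ring_mat_def hom_def Pi_iff)

lemma GL_hom_mult:
  "\<rho> \<in> hom G (GL n) \<Longrightarrow> g \<in> carrier G \<Longrightarrow> h \<in> carrier G \<Longrightarrow> \<rho> (g \<otimes> h) = \<rho> g * \<rho> h"
  using hom_mult[of \<rho> G "GL n" g h] by (simp add: GL_def units_of_def ring_mat_def)

lemma GL_hom_one: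
  assumes "\<rho> \<in> hom G (GL n)"
  shows "\<rho> \<one> = 1\<^sub>m n"
proof -
  interpret M: ring "ring_mat TYPE(complex) n ()" by (rule ring_mat)
  have "group (GL n)" unfolding GL_def by (rule M.units_group)
  then have "\<rho> \<one> = \<one>\<^bsub>GL n\<^esub>" using hom_one[OF assms] is_group by blast
  then show ?thesis by (simp add: GL_def units_of_def ring_mat_def)
qed

lemma GL_hom_pow:
  assumes "\<rho> \<in> hom G (GL n)" "g \<in> carrier G"
  shows "\<rho> (g [^] (k :: nat)) = \<rho> g ^\<^sub>m k"
proof (induct k)
  case 0
  then show ?case using GL_hom_one GL_hom_carrier assms by (metis carrier_matD(1) nat_pow_0 pow_mat.simps(1))
next
  case (Suc k)
  then show ?case using assms by (simp add: GL_hom_mult)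
qed

lemma GL_homI:
  assumes car: "\<And>g. g \<in> carrier G \<Longrightarrow> \<rho> g \<in> carrier_mat n n"
    and mult: "\<And>g h. g \<in> carrier G \<Longrightarrow> h \<in> carrier G \<Longrightarrow> \<rho> (g \<otimes> h) = \<rho> g * \<rho> h"
    and one: "\<rho> \<one> = 1\<^sub>m n"
  shows "\<rho> \<in> hom G (GL n)"
proof -
  have "\<rho> g \<in> Units (ring_mat TYPE(complex) n ())" if g: "g \<in> carrier G" for g
  proof -
    have "\<rho> (inv g) * \<rho> g = 1\<^sub>m n" "\<rho> g * \<rho> (inv g) = 1\<^sub>m n"
      using mult[of "inv g" g] mult[of g "inv g"] g one by auto
    then show ?thesis using car g by (auto simp: Units_def ring_mat_def intro!: bexI[of _ "\<rho> (inv g)"])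
  qed
  then show ?thesis using mult by (auto simp: hom_def GL_def units_of_def ring_mat_def)
qed

text \<open>
  In a basis adapted to a proper invariant subspace \<open>W\<close> all matrices are block upper triangular. The two
  diagonal blocks, that is, the actions on \<open>W\<close> and on the quotient by \<open>W\<close>, are representations
  themselves, and the trace is the sum of their traces.
\<close>
lemma reducible_rep_splits:
  assumes \<rho>: "\<rho> \<in> hom G (GL n)" and n: "n > 0" and red: "\<not> irreducible_rep G n \<rho>"
  obtains r \<sigma> \<tau> where "0 < r" "r < n" "\<sigma> \<in> hom G (GL r)" "\<tau> \<in> hom G (GL (n - r))"
    "rep_character G \<rho> = rep_character G \<sigma> + rep_character G \<tau>"
proof -
  obtain W where sub: "VectorSpace.subspace class_ring W (module_vec TYPE(complex) n)"
    and inv: "\<And>g w. g \<in> carrier G \<Longrightarrow> w \<in> W \<Longrightarrow> \<rho> g *\<^sub>v w \<in> W"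
    and W: "W \<noteq> {0\<^sub>v n}" "W \<noteq> carrier_vec n"
    using \<rho> n red unfolding irreducible_rep_def by blast
  obtain P Q r where P: "P \<in> carrier_mat n n" and Q: "Q \<in> carrier_mat n n"
    and PQ: "P * Q = 1\<^sub>m n" and QP: "Q * P = 1\<^sub>m n"
    and r: "r \<le> n" and colW: "\<And>j. j < r \<Longrightarrow> col P j \<in> W" and rn: "r = n \<Longrightarrow> W = carrier_vec n"
    and coord: "\<And>w. w \<in> W \<Longrightarrow> \<exists>v\<in>carrier_vec n. w = P *\<^sub>v v \<and> (\<forall>i. r \<le> i \<longrightarrow> i < n \<longrightarrow> v $ i = 0)"
    using subspace_adapted_basis[OF sub] by blast
  have "r < n" using r rn W(2) by linarith
  have "r > 0"
  proof (rule ccontr)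
    assume "\<not> r > 0"
    have "w = 0\<^sub>v n" if w: "w \<in> W" for w
    proof -
      obtain v where v: "v \<in> carrier_vec n" "w = P *\<^sub>v v" "\<forall>i<n. v $ i = 0"
        using coord[OF w] \<open>\<not> r > 0\<close> by auto
      then have "v = 0\<^sub>v n" by (intro eq_vecI) auto
      then show ?thesis using v(2) P by (auto intro!: eq_vecI)
    qed
    moreover have "0\<^sub>v n \<in> W"
      using sub unfolding VectorSpace.subspace_def submodule_def by (auto simp: module_vec_simps)
    ultimately show False using W(1) by blast
  qed
  define B where "B g = Q * \<rho> g * P" for g
  have \<rho>c: "\<rho> g \<in> carrier_mat n n" if "g \<in> carrier G" for g using GL_hom_carrier[OF \<rho> that] .
  have Bc: "B g \<in> carrier_mat n n" if "g \<in> carrier G" for g using P Q \<rho>c[OF that] by (simp add: B_def)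
  have Bmult: "B (g \<otimes> h) = B g * B h" if g: "g \<in> carrier G" and h: "h \<in> carrier G" for g h
  proof -
    note [simp] = assoc_mult_mat[of _ n n _ n _ n]
    have "B g * B h = Q * \<rho> g * (P * Q) * \<rho> h * P"
      using P Q \<rho>c[OF g] \<rho>c[OF h] by (simp add: B_def)
    then show ?thesis using P Q \<rho>c[OF g] \<rho>c[OF h] by (simp add: PQ B_def GL_hom_mult[OF \<rho> g h])
  qed
  have Bone: "B \<one> = 1\<^sub>m n" using P Q QP by (simp add: B_def GL_hom_one[OF \<rho>])
  \<comment> \<open>Invariance of \<open>W\<close> says that the lower left block vanishes.\<close>
  have Bzero: "B g $$ (i, j) = 0" if g: "g \<in> carrier G" and ij: "r \<le> i" "i < n" "j < r" for g i j
  proof -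
    obtain v where v: "v \<in> carrier_vec n" "\<rho> g *\<^sub>v col P j = P *\<^sub>v v" "v $ i = 0"
      using coord[OF inv[OF g colW[OF ij(3)]]] ij by auto
    have "col (B g) j = Q * \<rho> g *\<^sub>v col P j"
      unfolding B_def by (rule col_mult2[of _ n n _ n]) (use P Q \<rho>c[OF g] ij \<open>r < n\<close> in auto)
    also have "\<dots> = Q *\<^sub>v (\<rho> g *\<^sub>v col P j)"
      by (rule assoc_mult_mat_vec[of _ n n _ n]) (use P Q \<rho>c[OF g] ij \<open>r < n\<close> in auto)
    also have "\<dots> = Q * P *\<^sub>v v" using v P Q by simp
    also have "\<dots> = v" using v QP by simp
    finally show ?thesis using v Bc[OF g] ij \<open>r < n\<close> by (metis carrier_matD index_col less_trans)
  qed
  define \<sigma> where "\<sigma> g = mat r r (\<lambda>(i, j). B g $$ (i, j))" for g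
  define \<tau> where "\<tau> g = mat (n - r) (n - r) (\<lambda>(i, j). B g $$ (r + i, r + j))" for g
  have Bidx: "B (g \<otimes> h) $$ (i, j) = (\<Sum>k<r. B g $$ (i, k) * B h $$ (k, j)) + (\<Sum>k<n - r. B g $$ (i, r + k) * B h $$ (r + k, j))"
    if "g \<in> carrier G" "h \<in> carrier G" "i < n" "j < n" for g h i j
  proof -
    have "B (g \<otimes> h) $$ (i, j) = (\<Sum>k<n. B g $$ (i, k) * B h $$ (k, j))"
      using Bc[OF that(1)] Bc[OF that(2)] that by (simp add: Bmult scalar_prod_def atLeast0LessThan)
    also have "{..<n} = {..<r} \<union> {r..<n}" using \<open>r < n\<close> by auto
    also have "(\<Sum>k\<in>{..<r} \<union> {r..<n}. B g $$ (i, k) * B h $$ (k, j))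
      = (\<Sum>k<r. B g $$ (i, k) * B h $$ (k, j)) + (\<Sum>k=r..<n. B g $$ (i, k) * B h $$ (k, j))"
      by (rule sum.union_disjoint) auto
    also have "(\<Sum>k=r..<n. B g $$ (i, k) * B h $$ (k, j)) = (\<Sum>k<n - r. B g $$ (i, r + k) * B h $$ (r + k, j))"
      by (rule sum.reindex_bij_witness[of _ "\<lambda>k. r + k" "\<lambda>k. k - r"]) auto
    finally show ?thesis .
  qed
  show ?thesis
  proof (rule that)
    show "0 < r" "r < n" by fact+
    show "\<sigma> \<in> hom G (GL r)"
    proof (rule GL_homI)
      fix g h assume gh: "g \<in> carrier G" "h \<in> carrier G"
      show "\<sigma> (g \<otimes> h) = \<sigma> g * \<sigma> h"
        by (rule eq_matI) (use gh \<open>r < n\<close> in \<open>auto simp: \<sigma>_def Bidx Bzero scalar_prod_def atLeast0LessThan\<close>)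
    qed (use \<open>r < n\<close> in \<open>auto simp: \<sigma>_def Bone intro!: eq_matI\<close>)
    show "\<tau> \<in> hom G (GL (n - r))"
    proof (rule GL_homI)
      fix g h assume gh: "g \<in> carrier G" "h \<in> carrier G"
      show "\<tau> (g \<otimes> h) = \<tau> g * \<tau> h"
        by (rule eq_matI) (use gh \<open>r < n\<close> in \<open>auto simp: \<tau>_def Bidx Bzero scalar_prod_def atLeast0LessThan\<close>)
    qed (use \<open>r < n\<close> in \<open>auto simp: \<tau>_def Bone intro!: eq_matI\<close>)
    have "mat_trace (\<rho> g) = mat_trace (\<sigma> g) + mat_trace (\<tau> g)" if g: "g \<in> carrier G" for g
    proof -
      have "mat_trace (\<rho> g) = mat_trace (B g)"
        unfolding B_def using mat_trace_similar[OF Q P \<rho>c[OF g] PQ] by simp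
      also have "\<dots> = (\<Sum>i<n. B g $$ (i, i))" using Bc[OF g] by (simp add: mat_trace_def)
      also have "{..<n} = {..<r} \<union> {r..<n}" using \<open>r < n\<close> by auto
      also have "(\<Sum>i\<in>{..<r} \<union> {r..<n}. B g $$ (i, i)) = (\<Sum>i<r. B g $$ (i, i)) + (\<Sum>i=r..<n. B g $$ (i, i))"
        by (rule sum.union_disjoint) auto
      also have "(\<Sum>i=r..<n. B g $$ (i, i)) = (\<Sum>i<n - r. B g $$ (r + i, r + i))"
        by (rule sum.reindex_bij_witness[of _ "\<lambda>k. r + k" "\<lambda>k. k - r"]) auto
      finally show ?thesis by (simp add: mat_trace_def \<sigma>_def \<tau>_def)
    qed
    then show "rep_character G \<rho> = rep_character G \<sigma> + rep_character G \<tau>"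
      by (auto simp: rep_character_def fun_eq_iff)
  qed
qed

text \<open>
  By induction on the degree: the irreducible constituents are the factors of a composition series.
\<close>
theorem rep_character_in_characters:
  assumes "\<rho> \<in> hom G (GL n)" "n > 0"
  shows "rep_character G \<rho> \<in> characters G"
  using assms
proof (induction n arbitrary: \<rho> rule: less_induct)
  case (less n)
  show ?case
  proof (cases "irreducible_rep G n \<rho>")
    case True
    then have "rep_character G \<rho> \<in> Irr G" by (auto simp: Irr_def)
    then show ?thesis using Irr_subset_characters by blast
  next
    case False
    then obtain r \<sigma> \<tau> where "0 < r" "r < n" "\<sigma> \<in> hom G (GL r)" "\<tau> \<in> hom G (GL (n - r))"
      "rep_character G \<rho> = rep_character G \<sigma> + rep_character G \<tau>"
      using reducible_rep_splits less.prems by blast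
    then show ?thesis using less.IH[of r \<sigma>] less.IH[of "n - r" \<tau>] by (simp only: characters_add)
  qed
qed

section \<open>Permutation characters\<close>

text \<open>
  The trace of a permutation matrix counts fixed points.
\<close>
lemma permutation_character:
  assumes X: "finite X" "X \<noteq> {}"
    and closed: "\<And>g x. g \<in> carrier G \<Longrightarrow> x \<in> X \<Longrightarrow> \<phi> g x \<in> X"
    and mult: "\<And>g h x. g \<in> carrier G \<Longrightarrow> h \<in> carrier G \<Longrightarrow> x \<in> X \<Longrightarrow> \<phi> (g \<otimes> h) x = \<phi> g (\<phi> h x)"
    and one: "\<And>x. x \<in> X \<Longrightarrow> \<phi> \<one> x = x"
  shows "(\<lambda>g. if g \<in> carrier G then of_nat (card {x \<in> X. \<phi> g x = x}) else 0) \<in> rational_characters G"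
proof -
  define n where "n = card X"
  have n: "n > 0" using X by (simp add: n_def card_gt_0_iff)
  obtain e where e: "bij_betw e {..<n} X"
    using X ex_bij_betw_nat_finite[of X] by (auto simp: n_def atLeast0LessThan)
  have eX: "e i \<in> X" if "i < n" for i using e that by (auto simp: bij_betw_def)
  have einj: "e i = e j \<longleftrightarrow> i = j" if "i < n" "j < n" for i j
    using e that by (auto simp: bij_betw_def inj_on_def)
  have esurj: "\<exists>k<n. e k = x" if "x \<in> X" for x
    using e that unfolding bij_betw_def by auto
  define \<rho> where "\<rho> g = mat n n (\<lambda>(i, j). if \<phi> g (e j) = e i then 1 else 0 :: complex)" for g
  have hom: "\<rho> \<in> hom G (GL n)"
  proof (rule GL_homI)
    fix g h assume g: "g \<in> carrier G" and h: "h \<in> carrier G"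
    show "\<rho> (g \<otimes> h) = \<rho> g * \<rho> h"
    proof (rule eq_matI)
      fix i j assume "i < dim_row (\<rho> g * \<rho> h)" "j < dim_col (\<rho> g * \<rho> h)"
      then have i: "i < n" and j: "j < n" by (auto simp: \<rho>_def)
      obtain k where k: "k < n" "e k = \<phi> h (e j)" using esurj closed[OF h eX[OF j]] by blast
      have "(\<rho> g * \<rho> h) $$ (i, j) = (\<Sum>l<n. (if \<phi> g (e l) = e i then 1 else 0) * (if \<phi> h (e j) = e l then 1 else 0))"
        using i j by (simp add: \<rho>_def scalar_prod_def atLeast0LessThan)
      also have "\<dots> = (\<Sum>l<n. if l = k then (if \<phi> g (e k) = e i then 1 else 0) else 0)"
        by (rule sum.cong) (use einj[OF k(1)] in \<open>auto simp: k(2)[symmetric]\<close>)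
      also have "\<dots> = \<rho> (g \<otimes> h) $$ (i, j)"
        using i j k mult[OF g h eX[OF j]] by (simp add: \<rho>_def)
      finally show "\<rho> (g \<otimes> h) $$ (i, j) = (\<rho> g * \<rho> h) $$ (i, j)" ..
    qed (auto simp: \<rho>_def)
  qed (auto simp: \<rho>_def einj one eX intro!: eq_matI)
  have "mat_trace (\<rho> g) = of_nat (card {x \<in> X. \<phi> g x = x})" for g
  proof -
    have "mat_trace (\<rho> g) = (\<Sum>i<n. if \<phi> g (e i) = e i then 1 else 0)"
      by (simp add: mat_trace_def \<rho>_def)
    also have "\<dots> = (\<Sum>x\<in>X. if \<phi> g x = x then 1 else 0)"
      by (rule sum.reindex_bij_betw[OF e, of "\<lambda>x. if \<phi> g x = x then 1 else 0"])
    also have "\<dots> = of_nat (card {x \<in> X. \<phi> g x = x})"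
      using X(1) by (simp add: sum.If_cases Int_def)
    finally show ?thesis .
  qed
  then have "(\<lambda>g. if g \<in> carrier G then of_nat (card {x \<in> X. \<phi> g x = x}) else 0) = rep_character G \<rho>"
    by (simp add: rep_character_def fun_eq_iff)
  then have "(\<lambda>g. if g \<in> carrier G then of_nat (card {x \<in> X. \<phi> g x = x}) else 0) \<in> characters G"
    using rep_character_in_characters[OF hom n] by simp
  then show ?thesis by (simp add: rational_characters_def)
qed

text \<open>
  The coset \<open>aC\<close> is fixed by \<open>g\<close> if and only if \<open>a^{-1} g a\<close> lies in \<open>C\<close>, so the character of the action
  on the left cosets of \<open>C\<close> is nonzero exactly at the elements that have a conjugate in \<open>C\<close>.
\<close>
lemma coset_character:
  assumes fin: "finite (carrier G)" and C: "subgroup C G"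
  obtains \<pi> where "\<pi> \<in> rational_characters G"
    "\<And>g. g \<in> carrier G \<Longrightarrow> \<pi> g \<noteq> 0 \<longleftrightarrow> (\<exists>a\<in>carrier G. inv a \<otimes> g \<otimes> a \<in> C)"
proof -
  have Cc: "C \<subseteq> carrier G" using C by (rule subgroup.subset)
  define X where "X = (\<lambda>a. a <#\<^bsub>G\<^esub> C) ` carrier G"
  define \<pi> where "\<pi> = (\<lambda>g. if g \<in> carrier G then of_nat (card {A \<in> X. g <#\<^bsub>G\<^esub> A = A}) else 0 :: complex)"
  have finX: "finite X" using fin by (simp add: X_def)
  show ?thesis
  proof
    show "\<pi> \<in> rational_characters G"
      unfolding \<pi>_def
    proof (rule permutation_character[where X = X and \<phi> = "\<lambda>g A. g <#\<^bsub>G\<^esub> A"])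
      have Xc: "A \<subseteq> carrier G" if "A \<in> X" for A using that Cc l_coset_subset_G by (auto simp: X_def)
      show "X \<noteq> {}" by (auto simp: X_def)
      show "g <#\<^bsub>G\<^esub> A \<in> X" if "g \<in> carrier G" "A \<in> X" for g A
        using that lcos_m_assoc[OF Cc] by (auto simp: X_def)
      show "(g \<otimes> h) <#\<^bsub>G\<^esub> A = g <#\<^bsub>G\<^esub> (h <#\<^bsub>G\<^esub> A)"
        if "g \<in> carrier G" "h \<in> carrier G" "A \<in> X" for g h A
        using lcos_m_assoc[OF Xc[OF that(3)] that(1,2)] by simp
      show "\<one> <#\<^bsub>G\<^esub> A = A" if "A \<in> X" for A using lcos_mult_one[OF Xc[OF that]] .
    qed (rule finX)
    fix g assume g: "g \<in> carrier G"
    have fix_iff: "g <#\<^bsub>G\<^esub> (a <#\<^bsub>G\<^esub> C) = a <#\<^bsub>G\<^esub> C \<longleftrightarrow> inv a \<otimes> g \<otimes> a \<in> C" if a: "a \<in> carrier G" for a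
    proof
      assume eq: "g <#\<^bsub>G\<^esub> (a <#\<^bsub>G\<^esub> C) = a <#\<^bsub>G\<^esub> C"
      have "g \<otimes> a \<in> g <#\<^bsub>G\<^esub> (a <#\<^bsub>G\<^esub> C)"
        using C a g subgroup.one_closed[OF C] by (auto simp: l_coset_def intro!: bexI[of _ a] bexI[of _ \<one>])
      then obtain c where c: "c \<in> C" "g \<otimes> a = a \<otimes> c" unfolding eq by (auto simp: l_coset_def)
      have "inv a \<otimes> g \<otimes> a = inv a \<otimes> (a \<otimes> c)" using a g c(2) by (simp add: m_assoc)
      also have "\<dots> = c" using a subsetD[OF Cc c(1)] by (simp flip: m_assoc)
      finally have "inv a \<otimes> g \<otimes> a = c" .
      then show "inv a \<otimes> g \<otimes> a \<in> C" using c by simp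
    next
      assume mem: "inv a \<otimes> g \<otimes> a \<in> C"
      have "a \<otimes> (inv a \<otimes> g \<otimes> a) = g \<otimes> a" using a g by (simp flip: m_assoc)
      then have "g <#\<^bsub>G\<^esub> (a <#\<^bsub>G\<^esub> C) = (a \<otimes> (inv a \<otimes> g \<otimes> a)) <#\<^bsub>G\<^esub> C"
        using lcos_m_assoc[OF Cc g a] by simp
      also have "\<dots> = a <#\<^bsub>G\<^esub> ((inv a \<otimes> g \<otimes> a) <#\<^bsub>G\<^esub> C)"
        using lcos_m_assoc[OF Cc a, of "inv a \<otimes> g \<otimes> a"] a g by simp
      also have "(inv a \<otimes> g \<otimes> a) <#\<^bsub>G\<^esub> C = C" by (rule coset_join3[OF _ C mem]) (use a g in simp)
      finally show "g <#\<^bsub>G\<^esub> (a <#\<^bsub>G\<^esub> C) = a <#\<^bsub>G\<^esub> C" .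
    qed
    have "\<pi> g \<noteq> 0 \<longleftrightarrow> {A \<in> X. g <#\<^bsub>G\<^esub> A = A} \<noteq> {}" using g finX by (simp add: \<pi>_def)
    also have "\<dots> \<longleftrightarrow> (\<exists>a\<in>carrier G. inv a \<otimes> g \<otimes> a \<in> C)"
      using fix_iff by (auto simp: X_def)
    finally show "\<pi> g \<noteq> 0 \<longleftrightarrow> (\<exists>a\<in>carrier G. inv a \<otimes> g \<otimes> a \<in> C)" .
  qed
qed

section \<open>Classes of cyclic subgroups as classes of group elements\<close>

text \<open>
  The conjugacy class of the cyclic subgroup generated by \<open>x\<close>. Indexing by generators turns the set of
  classes into a partition of the elements of the group, on which characters can be evaluated.
\<close>
definition cyclic_class :: "'a \<Rightarrow> 'a set set"
  where "cyclic_class x = {generate G {g \<otimes> x \<otimes> inv g} | g. g \<in> carrier G}"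

lemma conj_generate:
  assumes g: "g \<in> carrier G" and x: "x \<in> carrier G"
  shows "g <#\<^bsub>G\<^esub> generate G {x} #>\<^bsub>G\<^esub> inv g = generate G {g \<otimes> x \<otimes> inv g}"
proof -
  let ?c = "\<lambda>y. g \<otimes> y \<otimes> inv g"
  have "?c \<in> hom G G"
  proof (rule homI)
    fix y z assume y: "y \<in> carrier G" and z: "z \<in> carrier G"
    have "inv g \<otimes> (g \<otimes> (z \<otimes> inv g)) = z \<otimes> inv g" using g z by (simp flip: m_assoc)
    then show "?c (y \<otimes> z) = ?c y \<otimes> ?c z" using g y z by (simp add: m_assoc)
  qed (use g in simp)
  then interpret c: group_hom G G ?c
    by (intro group_hom.intro group_hom_axioms.intro is_group)
  have "g <#\<^bsub>G\<^esub> generate G {x} #>\<^bsub>G\<^esub> inv g = ?c ` generate G {x}"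
    by (auto simp: l_coset_def r_coset_def)
  also have "\<dots> = generate G {?c x}" using c.generate_img[of "{x}"] x by simp
  finally show ?thesis .
qed

lemma cyclic_subgroup_classes_eq: "cyclic_subgroup_classes G = cyclic_class ` carrier G"
proof -
  have "orbit G (\<lambda>g. \<lambda>H\<in>cyclic_subgroups G. g <#\<^bsub>G\<^esub> H #>\<^bsub>G\<^esub> inv g) (generate G {x}) = cyclic_class x"
    if x: "x \<in> carrier G" for x
  proof -
    have "generate G {x} \<in> cyclic_subgroups G" using x by (auto simp: cyclic_subgroups_def)
    then show ?thesis using conj_generate x by (auto simp: orbit_def cyclic_class_def)
  qed
  then show ?thesis by (auto simp: cyclic_subgroup_classes_def orbits_def cyclic_subgroups_def)
qed

lemma cyclic_class_eq_iff:
  assumes x: "x \<in> carrier G" and y: "y \<in> carrier G"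
  shows "cyclic_class x = cyclic_class y \<longleftrightarrow> (\<exists>g\<in>carrier G. generate G {y} = generate G {g \<otimes> x \<otimes> inv g})"
proof
  assume eq: "cyclic_class x = cyclic_class y"
  have "generate G {y} \<in> cyclic_class y" unfolding cyclic_class_def using y by (auto intro!: exI[of _ \<one>])
  then show "\<exists>g\<in>carrier G. generate G {y} = generate G {g \<otimes> x \<otimes> inv g}"
    unfolding eq[symmetric] by (auto simp: cyclic_class_def)
next
  assume "\<exists>g\<in>carrier G. generate G {y} = generate G {g \<otimes> x \<otimes> inv g}"
  then obtain g where g: "g \<in> carrier G" and gen: "generate G {y} = generate G {g \<otimes> x \<otimes> inv g}" by blast
  have conj: "generate G {h \<otimes> y \<otimes> inv h} = generate G {(h \<otimes> g) \<otimes> x \<otimes> inv (h \<otimes> g)}" if h: "h \<in> carrier G" for h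
  proof -
    have "generate G {h \<otimes> y \<otimes> inv h} = generate G {h \<otimes> (g \<otimes> x \<otimes> inv g) \<otimes> inv h}"
      using conj_generate[OF h] g x y gen by (metis inv_closed m_closed)
    also have "h \<otimes> (g \<otimes> x \<otimes> inv g) \<otimes> inv h = (h \<otimes> g) \<otimes> x \<otimes> inv (h \<otimes> g)"
      using g h x by (simp add: m_assoc inv_mult_group)
    finally show ?thesis .
  qed
  show "cyclic_class x = cyclic_class y"
  proof
    show "cyclic_class y \<subseteq> cyclic_class x"
      using conj g by (auto simp: cyclic_class_def)
    show "cyclic_class x \<subseteq> cyclic_class y"
    proof
      fix H assume "H \<in> cyclic_class x"
      then obtain h where h: "h \<in> carrier G" "H = generate G {h \<otimes> x \<otimes> inv h}" by (auto simp: cyclic_class_def)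
      have "(h \<otimes> inv g) \<otimes> g = h" using g h by (simp add: m_assoc)
      then have "H = generate G {(h \<otimes> inv g) \<otimes> y \<otimes> inv (h \<otimes> inv g)}"
        using conj[of "h \<otimes> inv g"] g h by simp
      then show "H \<in> cyclic_class y" using g h by (auto simp: cyclic_class_def)
    qed
  qed
qed

section \<open>Rational characters are constant on these classes\<close>

text \<open>
  The list consists of the eigenvalues, with multiplicity, of \<open>x\<close> in a representation with character \<open>\<chi>\<close>. Such
  lists are concatenated when characters are added, and those of irreducible characters come from
  triangulation.
\<close>
lemma character_power_sums:
  assumes \<chi>: "\<chi> \<in> characters G" and x: "x \<in> carrier G"
  shows "\<exists>ls. (\<forall>l\<in>set ls. l ^ ord x = 1) \<and> (\<forall>k::nat. \<chi> (x [^] k) = (\<Sum>l\<leftarrow>ls. l ^ k))"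
proof -
  let ?P = "\<lambda>f :: 'a \<Rightarrow> complex. \<exists>ls. (\<forall>l\<in>set ls. l ^ ord x = 1) \<and> (\<forall>k::nat. f (x [^] k) = (\<Sum>l\<leftarrow>ls. l ^ k))"
  have zero: "?P 0" by (intro exI[of _ "[]"]) simp
  have add: "?P (f + h)" if f: "?P f" and h: "?P h" for f h
  proof -
    obtain ls ls' where "\<forall>l\<in>set ls. l ^ ord x = 1" "\<forall>k::nat. f (x [^] k) = (\<Sum>l\<leftarrow>ls. l ^ k)"
      "\<forall>l\<in>set ls'. l ^ ord x = 1" "\<forall>k::nat. h (x [^] k) = (\<Sum>l\<leftarrow>ls'. l ^ k)"
      using f h by blast
    then show ?thesis by (intro exI[of _ "ls @ ls'"]) auto
  qed
  have irr: "?P \<psi>" if \<psi>_irr: "\<psi> \<in> Irr G" for \<psi>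
  proof -
    obtain n \<rho> where "\<rho> \<in> hom G (GL n)" and \<psi>: "\<psi> = rep_character G \<rho>"
      using \<psi>_irr unfolding Irr_def irreducible_rep_def by blast
    note \<rho> = this(1)
    have "\<rho> x ^\<^sub>m ord x = 1\<^sub>m n"
      using GL_hom_pow[OF \<rho> x, of "ord x"] GL_hom_one[OF \<rho>] x by simp
    then show ?thesis
      using finite_order_mat_trace_pow[OF GL_hom_carrier[OF \<rho> x], of "ord x"] x
      by (simp add: \<psi> rep_character_def GL_hom_pow[OF \<rho> x])
  qed
  have scale: "?P (cfun_scale (of_nat m) \<psi>)" if "\<psi> \<in> Irr G" for m \<psi>
  proof (induct m)
    case 0
    then show ?case using zero by simp
  next
    case (Suc m)
    then show ?case using add[OF irr[OF that]] by (simp only: of_nat_Suc cfun.scale_left_distrib cfun.scale_one)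
  qed
  have sums: "finite S \<Longrightarrow> S \<subseteq> Irr G \<Longrightarrow> ?P (\<Sum>\<psi>\<in>S. cfun_scale (of_nat (m \<psi>)) \<psi>)" for S and m :: "_ \<Rightarrow> nat"
  proof (induct S rule: finite_induct)
    case empty
    then show ?case using zero by simp
  next
    case (insert \<psi> S)
    then show ?case using add[OF scale[of \<psi> "m \<psi>"]] by simp
  qed
  show ?thesis using \<chi> sums by (auto simp: characters_def)
qed

text \<open>
  Two generators of the same cyclic group are powers of each other with exponents coprime to the order, so
  this is the statement on rational power sums, applied to the eigenvalues of \<open>x\<close>.
\<close>
lemma rational_character_eq_if_generate_eq:
  assumes fin: "finite (carrier G)" and \<chi>: "\<chi> \<in> rational_characters G"
    and x: "x \<in> carrier G" and y: "y \<in> carrier G" and gen: "generate G {x} = generate G {y}"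
  shows "\<chi> x = \<chi> y"
proof -
  have N: "ord x > 0" using ord_ge_1[OF fin x] by simp
  have ordy: "ord y = ord x" using gen generate_pow_card x y by metis
  have "y \<in> generate G {x}" unfolding gen by (rule generate.incl) simp
  then obtain k :: nat where k: "y = x [^] k"
    using generate_pow_on_finite_carrier[OF fin x] by auto
  have cop: "coprime k (ord x)"
  proof (cases "k = 0")
    case True
    then show ?thesis using ordy ord_pow_gen[OF x, of k] k by simp
  next
    case False
    then have "ord x div gcd (ord x) k = ord x" using ordy ord_pow_gen[OF x, of k] k by simp
    then have "gcd (ord x) k = 1" using N by (simp only: div_eq_dividend_iff)
    then show ?thesis by (metis coprime_iff_gcd_eq_1 coprime_commute)
  qed
  have char: "\<chi> \<in> characters G" and rat_val: "\<And>g. g \<in> carrier G \<Longrightarrow> \<chi> g \<in> \<rat>"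
    using \<chi> by (simp_all add: rational_characters_def)
  obtain ls where ls: "\<forall>l\<in>set ls. l ^ ord x = 1" "\<forall>k::nat. \<chi> (x [^] k) = (\<Sum>l\<leftarrow>ls. l ^ k)"
    using character_power_sums[OF char x] by blast
  have rat: "(\<Sum>l\<leftarrow>ls. l ^ j) \<in> \<rat>" for j
    using rat_val[of "x [^] j"] ls(2) x by simp
  have "\<chi> y = sum_list ls" unfolding k ls(2)[rule_format] by (rule rational_power_sums_coprime_eq[OF N ls(1) rat cop])
  also have "\<dots> = \<chi> x" using ls(2)[rule_format, of 1] x by simp
  finally show ?thesis ..
qed

lemma rational_character_eq_if_cyclic_class_eq:
  assumes fin: "finite (carrier G)" and \<chi>: "\<chi> \<in> rational_characters G"
    and x: "x \<in> carrier G" and y: "y \<in> carrier G" and cls: "cyclic_class x = cyclic_class y"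
  shows "\<chi> x = \<chi> y"
proof -
  obtain g where g: "g \<in> carrier G" "generate G {y} = generate G {g \<otimes> x \<otimes> inv g}"
    using cls cyclic_class_eq_iff[OF x y] by blast
  have "\<chi> \<in> class_functions G"
    using \<chi> characters_subset_class_functions[OF is_group] by (auto simp: rational_characters_def)
  then have "\<chi> x = \<chi> (g \<otimes> x \<otimes> inv g)" using g x by (simp add: class_functions_def)
  also have "\<dots> = \<chi> y" using rational_character_eq_if_generate_eq[OF fin \<chi>, of "g \<otimes> x \<otimes> inv g" y] g x y by simp
  finally show ?thesis .
qed

section \<open>Indicator functions span the rational characters\<close>

definition class_indicator :: "'a set set \<Rightarrow> 'a \<Rightarrow> complex"
  where "class_indicator K = (\<lambda>x. if x \<in> carrier G \<and> cyclic_class x = K then 1 else 0)"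

definition class_rep :: "'a set set \<Rightarrow> 'a"
  where "class_rep K = (SOME x. x \<in> carrier G \<and> cyclic_class x = K)"

lemma class_rep:
  assumes "K \<in> cyclic_subgroup_classes G"
  shows "class_rep K \<in> carrier G" "cyclic_class (class_rep K) = K"
proof -
  have "\<exists>x. x \<in> carrier G \<and> cyclic_class x = K"
    using assms by (auto simp: cyclic_subgroup_classes_eq)
  then show "class_rep K \<in> carrier G" "cyclic_class (class_rep K) = K"
    unfolding class_rep_def by (metis (mono_tags, lifting) someI_ex)+
qed

lemma finite_cyclic_subgroup_classes: "finite (carrier G) \<Longrightarrow> finite (cyclic_subgroup_classes G)"
  by (simp add: cyclic_subgroup_classes_eq)

lemma sum_fun_apply: "(\<Sum>i\<in>A. f i) x = (\<Sum>i\<in>A. f i x :: 'c :: comm_monoid_add)"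
  by (induct A rule: infinite_finite_induct) auto

text \<open>
  The upper bound for the dimension: a rational character is determined by one value for each class of cyclic
  subgroups.
\<close>
lemma rational_character_expansion:
  assumes fin: "finite (carrier G)" and \<chi>: "\<chi> \<in> rational_characters G"
  shows "\<chi> = (\<Sum>K\<in>cyclic_subgroup_classes G. cfun_scale (\<chi> (class_rep K)) (class_indicator K))"
proof
  fix x
  let ?K = "cyclic_subgroup_classes G"
  have "(\<Sum>K\<in>?K. cfun_scale (\<chi> (class_rep K)) (class_indicator K)) x
      = (\<Sum>K\<in>?K. \<chi> (class_rep K) * class_indicator K x)"
    by (simp add: sum_fun_apply cfun_scale_def)
  also have "\<dots> = \<chi> x"
  proof (cases "x \<in> carrier G")
    case True
    then have mem: "cyclic_class x \<in> ?K" by (simp add: cyclic_subgroup_classes_eq)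
    have "(\<Sum>K\<in>?K. \<chi> (class_rep K) * class_indicator K x) = (\<Sum>K\<in>?K. if K = cyclic_class x then \<chi> (class_rep K) else 0)"
      by (rule sum.cong) (auto simp: class_indicator_def True)
    also have "\<dots> = \<chi> (class_rep (cyclic_class x))"
      using mem finite_cyclic_subgroup_classes[OF fin] by simp
    also have "\<dots> = \<chi> x"
      using class_rep[OF mem] True by (intro rational_character_eq_if_cyclic_class_eq[OF fin \<chi>])
    finally show ?thesis .
  next
    case False
    have "\<chi> \<in> class_functions G"
      using \<chi> characters_subset_class_functions[OF is_group] by (auto simp: rational_characters_def)
    then show ?thesis using False by (simp add: class_functions_def class_indicator_def)
  qed
  finally show "\<chi> x = (\<Sum>K\<in>?K. cfun_scale (\<chi> (class_rep K)) (class_indicator K)) x" ..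
qed

text \<open>
  The lower bound for the dimension. The coset character of the subgroup \<open>C\<close> generated by \<open>x\<close> does not vanish
  at \<open>x\<close>, so its expansion can be solved for the indicator function of the class of \<open>C\<close>. Every other class at
  which it does not vanish contains a proper subgroup of \<open>C\<close>, which the induction hypothesis covers.
\<close>
lemma class_indicator_in_span_rational_characters:
  assumes fin: "finite (carrier G)" and "x \<in> carrier G"
  shows "class_indicator (cyclic_class x) \<in> cfun.span (rational_characters G)"
  using assms(2)
proof (induction "card (generate G {x})" arbitrary: x rule: less_induct)
  case less
  note x = less.prems
  let ?C = "generate G {x}" and ?V = "cfun.span (rational_characters G)" and ?K = "cyclic_subgroup_classes G"
  have C: "subgroup ?C G" using x by (intro generate_is_subgroup) simp
  have finC: "finite ?C" using subgroup.subset[OF C] fin finite_subset by blast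
  obtain \<pi> where \<pi>: "\<pi> \<in> rational_characters G"
    and nz: "\<And>g. g \<in> carrier G \<Longrightarrow> \<pi> g \<noteq> 0 \<longleftrightarrow> (\<exists>a\<in>carrier G. inv a \<otimes> g \<otimes> a \<in> ?C)"
    using coset_character[OF fin C] by blast
  have mem: "cyclic_class x \<in> ?K" using x by (simp add: cyclic_subgroup_classes_eq)
  have smaller: "cfun_scale (\<pi> (class_rep K)) (class_indicator K) \<in> ?V" if K: "K \<in> ?K - {cyclic_class x}" for K
  proof (cases "\<pi> (class_rep K) = 0")
    case True
    then show ?thesis by (simp add: cfun.span_zero)
  next
    case False
    define y where "y = class_rep K"
    have y: "y \<in> carrier G" "cyclic_class y = K" using class_rep K by (auto simp: y_def)
    then obtain a where a: "a \<in> carrier G" "inv a \<otimes> y \<otimes> a \<in> ?C"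
      using nz False by (auto simp: y_def)
    define z where "z = inv a \<otimes> y \<otimes> a"
    have z: "z \<in> carrier G" using a y by (simp add: z_def)
    have clz: "cyclic_class z = K"
      using cyclic_class_eq_iff[OF y(1) z] y(2) a by (metis inv_closed inv_inv z_def)
    have sub: "generate G {z} \<subseteq> ?C" using generate_subgroup_incl[OF _ C] a by (simp add: z_def)
    have "generate G {z} \<noteq> ?C"
    proof
      assume "generate G {z} = ?C"
      then have "generate G {z} = generate G {\<one> \<otimes> x \<otimes> inv \<one>}" using x by simp
      then have "cyclic_class x = cyclic_class z"
        using cyclic_class_eq_iff[OF x z] one_closed by metis
      then show False using clz K by simp
    qed
    then have "card (generate G {z}) < card ?C" using sub finC by (simp add: psubset_card_mono psubset_eq)
    then have "class_indicator (cyclic_class z) \<in> ?V" using less.hyps z by blast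
    then show ?thesis using clz cfun.span_scale by simp
  qed
  have "\<pi> (class_rep (cyclic_class x)) = \<pi> x"
    using class_rep[OF mem] x by (intro rational_character_eq_if_cyclic_class_eq[OF fin \<pi>])
  then have "\<pi> = cfun_scale (\<pi> x) (class_indicator (cyclic_class x))
      + (\<Sum>K\<in>?K - {cyclic_class x}. cfun_scale (\<pi> (class_rep K)) (class_indicator K))"
    using rational_character_expansion[OF fin \<pi>] sum.remove[OF finite_cyclic_subgroup_classes[OF fin] mem] by metis
  then have "cfun_scale (\<pi> x) (class_indicator (cyclic_class x))
      = \<pi> - (\<Sum>K\<in>?K - {cyclic_class x}. cfun_scale (\<pi> (class_rep K)) (class_indicator K))"
    by (metis add_diff_cancel_right')
  also have "\<dots> \<in> ?V"
    by (rule cfun.span_diff[OF cfun.span_base[OF \<pi>] cfun.span_sum[OF smaller]])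
  finally have "cfun_scale (inverse (\<pi> x)) (cfun_scale (\<pi> x) (class_indicator (cyclic_class x))) \<in> ?V"
    by (rule cfun.span_scale)
  moreover have "\<pi> x \<noteq> 0"
  proof -
    have "inv \<one> \<otimes> x \<otimes> \<one> \<in> ?C" using x generate.incl[of x "{x}" G] by simp
    then show ?thesis using nz[OF x] one_closed by metis
  qed
  ultimately show ?case by simp
qed

lemma class_indicator_at_rep:
  assumes "K \<in> cyclic_subgroup_classes G"
  shows "class_indicator L (class_rep K) = (if L = K then 1 else 0)"
  using class_rep[OF assms] by (auto simp: class_indicator_def)

lemma inj_on_class_indicator: "inj_on class_indicator (cyclic_subgroup_classes G)"
  by (rule inj_onI) (metis class_indicator_at_rep zero_neq_one)

text \<open>
  Evaluating a linear relation at a representative of a class isolates the coefficient of that class.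
\<close>
lemma independent_class_indicators:
  assumes fin: "finite (carrier G)"
  shows "cfun.independent (class_indicator ` cyclic_subgroup_classes G)"
proof -
  let ?K = "cyclic_subgroup_classes G"
  have "u v = 0" if eq: "(\<Sum>v\<in>class_indicator ` ?K. cfun_scale (u v) v) = 0" and v: "v \<in> class_indicator ` ?K" for u v
  proof -
    obtain K where K: "K \<in> ?K" "v = class_indicator K" using v by blast
    have "0 = (\<Sum>L\<in>?K. cfun_scale (u (class_indicator L)) (class_indicator L)) (class_rep K)"
      using eq by (simp add: sum.reindex[OF inj_on_class_indicator])
    also have "\<dots> = (\<Sum>L\<in>?K. if L = K then u (class_indicator L) else 0)"
      unfolding sum_fun_apply by (rule sum.cong) (auto simp: cfun_scale_def class_indicator_at_rep[OF K(1)])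
    also have "\<dots> = u v" using K finite_cyclic_subgroup_classes[OF fin] by simp
    finally show ?thesis ..
  qed
  then show ?thesis
    using finite_cyclic_subgroup_classes[OF fin] by (auto simp: cfun.dependent_finite)
qed

lemma span_rational_characters_eq:
  assumes fin: "finite (carrier G)"
  shows "cfun.span (rational_characters G) = cfun.span (class_indicator ` cyclic_subgroup_classes G)"
proof (rule antisym)
  show "cfun.span (rational_characters G) \<subseteq> cfun.span (class_indicator ` cyclic_subgroup_classes G)"
  proof (rule cfun.span_minimal)
    show "rational_characters G \<subseteq> cfun.span (class_indicator ` cyclic_subgroup_classes G)"
    proof
      fix \<chi> assume "\<chi> \<in> rational_characters G"
      from rational_character_expansion[OF fin this]
      show "\<chi> \<in> cfun.span (class_indicator ` cyclic_subgroup_classes G)"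
        by (rule ssubst) (rule cfun.span_sum, rule cfun.span_scale, rule cfun.span_base, rule imageI)
    qed
  qed (rule cfun.subspace_span)
  show "cfun.span (class_indicator ` cyclic_subgroup_classes G) \<subseteq> cfun.span (rational_characters G)"
    using class_indicator_in_span_rational_characters[OF fin]
    by (intro cfun.span_minimal cfun.subspace_span) (auto simp: cyclic_subgroup_classes_eq)
qed

end

theorem theorem2:
  fixes G :: "('a, 'b) monoid_scheme"
  assumes "group G" and "finite (carrier G)"
  shows "cfun.dim (cfun.span (rational_characters G)) = card (cyclic_subgroup_classes G)"
proof -
  interpret group G by fact
  show ?thesis
    unfolding span_rational_characters_eq[OF assms(2)]
    using cfun.dim_span_eq_card_independent[OF independent_class_indicators[OF assms(2)]]
    by (simp add: card_image inj_on_class_indicator)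
qed

end
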